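(* Let $\Phi\colon\mathbb{R}\to\mathbb{R}_+$ be a non-decreasing function. Assume that $\Phi$ is convex, twice continuously differentiable, and satisfies $\Phi'(u)>0$ and $\Phi''(u)>0$ for any $u\ge 0$. Then, for any $A>0$, $$\inf_{\tau\in[0,A]}\ \sup_{u\in\mathbb{R}}\left\{\Phi(\tau)-\frac{1-t}{2}\Phi(\tau+u)-\frac{1+t}{2}\Phi(\tau-u)\right\}=\Theta(t^2),$$ that is, denoting the left-hand side by $G_A(t)$ for $t\in[0,1]$, there exist constants $C>0$, $c>0$, $T>0$ such that $Ct^2\ge G_A(t)\ge ct^2$ for all $0<t\le T$. *)

theory Defs
  imports "HOL-Analysis.Analysis"
begin

definition twice_continuously_differentiable :: "(real \<Rightarrow> real) \<Rightarrow> bool" where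
  "twice_continuously_differentiable f \<longleftrightarrow>
     f differentiable_on UNIV \<and> deriv f differentiable_on UNIV \<and>
     continuous_on UNIV (deriv (deriv f))"

definition gap :: "(real \<Rightarrow> real) \<Rightarrow> real \<Rightarrow> real \<Rightarrow> real \<Rightarrow> real" where
  "gap \<Phi> t \<tau> u = \<Phi> \<tau> - (1 - t) / 2 * \<Phi> (\<tau> + u) - (1 + t) / 2 * \<Phi> (\<tau> - u)"

definition G :: "(real \<Rightarrow> real) \<Rightarrow> real \<Rightarrow> real \<Rightarrow> real" where
  "G \<Phi> A t = (INF \<tau>\<in>{0..A}. SUP u. gap \<Phi> t \<tau> u)"

text \<open>
  The infimum and supremum in \<^const>\<open>G\<close> are taken in the conditionally complete
  type \<^typ>\<open>real\<close>. The following two facts show that for nonnegative \<open>\<Phi>\<close> and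
  \<open>t \<in> [0, 1]\<close> they range over bounded sets, hence agree with the extended-real ones.
\<close>

lemma bdd_above_gap:
  assumes "\<And>x. 0 \<le> \<Phi> x" "0 \<le> t" "t \<le> 1"
  shows "bdd_above (range (gap \<Phi> t \<tau>))"
proof (rule bdd_aboveI2)
  fix u
  have "0 \<le> (1 - t) / 2 * \<Phi> (\<tau> + u)" "0 \<le> (1 + t) / 2 * \<Phi> (\<tau> - u)"
    using assms by (intro mult_nonneg_nonneg; simp)+
  then show "gap \<Phi> t \<tau> u \<le> \<Phi> \<tau>"
    unfolding gap_def by linarith
qed

lemma bdd_below_SUP_gap:
  assumes "\<And>x. 0 \<le> \<Phi> x" "0 \<le> t" "t \<le> 1"
  shows "bdd_below ((\<lambda>\<tau>. SUP u. gap \<Phi> t \<tau> u) ` {0..A})"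
proof (rule bdd_belowI2)
  fix \<tau>
  have "gap \<Phi> t \<tau> 0 = 0"
    by (simp add: gap_def field_simps)
  moreover have "gap \<Phi> t \<tau> 0 \<le> (SUP u. gap \<Phi> t \<tau> u)"
    by (rule cSUP_upper[OF UNIV_I bdd_above_gap[OF assms]])
  ultimately show "0 \<le> (SUP u. gap \<Phi> t \<tau> u)"
    by simp
qed

end

theory Submission
  imports Defs
begin

text \<open>
  At \<open>u = 0\<close> the gap vanishes and has slope \<open>t \<Phi>'(\<tau>)\<close>, and it is concave in \<open>u\<close> with curvature
  of order one near \<open>0\<close>. So its supremum is comparable to the maximum of \<open>t p u - m u\<^sup>2\<close>, which is
  of order \<open>t\<^sup>2\<close> and attained at some \<open>u\<close> of order \<open>t\<close>. For the upper bound on the infimum a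
  single \<open>\<tau>\<close> suffices; at \<open>\<tau> = 0\<close> a quadratic lower bound of \<open>\<Phi>\<close> is only needed on the right,
  and the tangent at \<open>0\<close> bounds \<open>\<Phi>\<close> on the left.
\<close>

lemma twice_continuously_differentiable_derivs:
  assumes "twice_continuously_differentiable f"
  shows "(f has_real_derivative deriv f x) (at x)"
    and "(deriv f has_real_derivative deriv (deriv f) x) (at x)"
  using assms
  by (auto simp: twice_continuously_differentiable_def differentiable_on_def
      DERIV_deriv_iff_real_differentiable)

lemma Taylor_second_order:
  fixes f :: "real \<Rightarrow> real"
  assumes "twice_continuously_differentiable f"
  obtains z where "z \<in> closed_segment c x"
    "f x = f c + deriv f c * (x - c) + deriv (deriv f) z / 2 * (x - c)\<^sup>2"
\<comment> \<open>The rule \<open>Taylor\<close> requires \<open>x \<noteq> c\<close>; in the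
  degenerate case the quadratic term vanishes, so any \<open>z\<close> serves.\<close>
proof (cases "x = c")
  case True
  then show ?thesis
    using that[of c] by simp
next
  case False
  have "\<exists>z. (if x < c then x < z \<and> z < c else c < z \<and> z < x) \<and>
     f x = (\<Sum>m<2. (deriv ^^ m) f c / fact m * (x - c) ^ m) + (deriv ^^ 2) f z / fact 2 * (x - c) ^ 2"
    by (rule Taylor[where a = "min x c" and b = "max x c"])
      (use False twice_continuously_differentiable_derivs[OF assms] in
        \<open>auto simp: less_2_cases_iff\<close>)
  then obtain z where z: "if x < c then x < z \<and> z < c else c < z \<and> z < x"
      "f x = (\<Sum>m<2. (deriv ^^ m) f c / fact m * (x - c) ^ m) + (deriv ^^ 2) f z / fact 2 * (x - c) ^ 2"
    by blast
  show ?thesis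
  proof (rule that)
    show "z \<in> closed_segment c x"
      using z(1) by (auto simp: closed_segment_eq_real_ivl split: if_splits)
    show "f x = f c + deriv f c * (x - c) + deriv (deriv f) z / 2 * (x - c)\<^sup>2"
      using z(2) by (simp add: numeral_2_eq_2)
  qed
qed

lemma above_tangent:
  fixes f :: "real \<Rightarrow> real"
  assumes "convex_on UNIV f" "(f has_real_derivative d) (at c)"
  shows "f c + d * (x - c) \<le> f x"
  using convex_on_imp_above_tangent[where A = UNIV and f = f and c = c and x = x and f' = d] assms
  by (simp add: algebra_simps)

lemma quadratic_max_bound:
  fixes q s u :: real
  assumes "0 < q"
  shows "s * u - q * u\<^sup>2 \<le> s\<^sup>2 / (4 * q)"
proof -
  have "0 \<le> (2 * q * u - s)\<^sup>2"
    by simp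
  then show ?thesis
    using assms by (simp add: field_simps power2_eq_square)
qed

text \<open>The curvature bound \<open>m\<close> is available only on \<open>{0..A}\<close>, so
  \<open>u\<close> is split into three ranges: the parabola decides on \<open>{0..A}\<close>, and
  outside it the gap is at most 0.\<close>

lemma gap_upper_bound:
  assumes convex: "convex_on UNIV \<Phi>"
    and smooth: "twice_continuously_differentiable \<Phi>"
    and curv: "\<And>z. z \<in> {0..A} \<Longrightarrow> m \<le> deriv (deriv \<Phi>) z"
    and m: "0 < m" and A: "0 < A" and p: "0 < deriv \<Phi> 0"
    and t: "0 \<le> t" "t \<le> 1 / 2" "8 * deriv \<Phi> 0 * t \<le> m * A"
  shows "gap \<Phi> t 0 u \<le> 2 * (deriv \<Phi> 0)\<^sup>2 / m * t\<^sup>2"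
proof -
  define p where "p = deriv \<Phi> 0"
  \<comment> \<open>Excess over the tangent at 0. The two weights sum to 1, so the affine part of
    \<open>\<Phi>\<close> contributes only \<open>t * p * u\<close> to the gap.\<close>
  define h where "h v = \<Phi> v - \<Phi> 0 - p * v" for v
  have h_nonneg: "0 \<le> h v" for v
    using above_tangent[OF convex twice_continuously_differentiable_derivs(1)[OF smooth], of 0 v]
    by (simp add: h_def p_def)
  have h_ge: "m / 2 * v\<^sup>2 \<le> h v" if v: "0 \<le> v" "v \<le> A" for v
  proof -
    obtain z where z: "z \<in> closed_segment 0 v"
      "\<Phi> v = \<Phi> 0 + deriv \<Phi> 0 * (v - 0) + deriv (deriv \<Phi>) z / 2 * (v - 0)\<^sup>2"
      using Taylor_second_order[OF smooth] by blast
    then have "m / 2 * v\<^sup>2 \<le> deriv (deriv \<Phi>) z / 2 * v\<^sup>2"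
      using curv[of z] v by (intro mult_right_mono) (auto simp: closed_segment_eq_real_ivl)
    then show ?thesis
      using z by (simp add: h_def p_def)
  qed
  have gap: "gap \<Phi> t 0 u = t * p * u - (1 - t) / 2 * h u - (1 + t) / 2 * h (- u)"
    by (simp add: gap_def h_def field_simps)
  \<comment> \<open>\<open>t \<le> 1 / 2\<close> keeps the weight of \<open>h u\<close> at least
    1/4; the term in \<open>h (- u)\<close> is discarded.\<close>
  have "1 / 4 * h u \<le> (1 - t) / 2 * h u" "0 \<le> (1 + t) / 2 * h (- u)"
    using t h_nonneg by (intro mult_right_mono mult_nonneg_nonneg; simp)+
  then have le: "gap \<Phi> t 0 u \<le> t * p * u - h u / 4"
    unfolding gap by linarith
  have bound: "0 \<le> 2 * p\<^sup>2 / m * t\<^sup>2"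
    using m by simp
  consider "u \<le> 0" | "0 \<le> u" "u \<le> A" | "A < u"
    by linarith
  then show ?thesis
  proof cases
    case 1
    then have "t * p * u \<le> 0"
      using t p by (simp add: p_def mult_nonneg_nonpos)
    then show ?thesis
      using le h_nonneg[of u] bound unfolding p_def by linarith
  next
    case 2
    have "gap \<Phi> t 0 u \<le> t * p * u - m / 8 * u\<^sup>2"
      using le h_ge[OF 2] by simp
    also have "\<dots> \<le> (t * p)\<^sup>2 / (4 * (m / 8))"
      using m by (intro quadratic_max_bound) simp
    also have "\<dots> = 2 * p\<^sup>2 / m * t\<^sup>2"
      by (simp add: power_mult_distrib)
    finally show ?thesis
      by (simp add: p_def)
  next
    case 3
    \<comment> \<open>\<open>A\<close> lies on the chord from 0 to \<open>u\<close> and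
      \<open>h 0 = 0\<close>, so beyond \<open>A\<close> the function \<open>h\<close> grows at
      least linearly, with slope \<open>h A / A \<ge> m * A / 2\<close>. A quarter of this slope
      dominates \<open>t * p\<close> by the third condition on \<open>t\<close>.\<close>
    have "\<Phi> ((1 - A / u) *\<^sub>R 0 + (A / u) *\<^sub>R u) \<le> (1 - A / u) * \<Phi> 0 + A / u * \<Phi> u"
      using 3 A by (intro convex_onD[OF convex]) auto
    then have "h A \<le> A / u * h u"
      using 3 A by (simp add: h_def field_simps)
    moreover have "m / 2 * A\<^sup>2 \<le> h A"
      using h_ge[of A] A by simp
    ultimately have "m / 2 * A\<^sup>2 \<le> A / u * h u"
      by linarith
    then have "A * (m / 2 * A) \<le> A * (h u / u)"
      by (simp add: power2_eq_square mult_ac)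
    then have "m / 2 * A \<le> h u / u"
      using A by (simp only: mult_le_cancel_left_pos)
    then have "m / 2 * A * u \<le> h u"
      using 3 A by (simp add: field_simps)
    moreover have "8 * p * t * u \<le> m * A * u"
      using t 3 A by (intro mult_right_mono) (auto simp: p_def)
    ultimately have "gap \<Phi> t 0 u \<le> 0"
      using le by (simp add: algebra_simps)
    then show ?thesis
      using bound unfolding p_def by linarith
  qed
qed

text \<open>Taylor's formula with curvature at most \<open>M\<close> bounds the gap below by
  \<open>t * p * u - M / 2 * u\<^sup>2\<close> for \<open>0 \<le> u \<le> 1\<close>; the chosen
  \<open>u\<close> is the vertex of this parabola.\<close>

lemma gap_lower_bound:
  assumes smooth: "twice_continuously_differentiable \<Phi>"
    and curv: "\<And>z. z \<in> {\<tau> - 1..\<tau> + 1} \<Longrightarrow> deriv (deriv \<Phi>) z \<le> M"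
    and p: "0 \<le> p" "p \<le> deriv \<Phi> \<tau>" "p \<le> M" and M: "0 < M"
    and t: "0 \<le> t" "t \<le> 1"
  shows "p\<^sup>2 / (2 * M) * t\<^sup>2 \<le> gap \<Phi> t \<tau> (p / M * t)"
proof -
  define u where "u = p / M * t"
  \<comment> \<open>\<open>p \<le> M\<close> keeps the vertex within distance 1, where
    \<open>curv\<close> applies.\<close>
  have u: "0 \<le> u" "u \<le> 1"
    using assms mult_mono[of "p / M" 1 t 1] by (auto simp: u_def)
  have upper: "\<Phi> (\<tau> + v) \<le> \<Phi> \<tau> + deriv \<Phi> \<tau> * v + M / 2 * v\<^sup>2" if "\<bar>v\<bar> \<le> 1" for v
  proof -
    obtain z where z: "z \<in> closed_segment \<tau> (\<tau> + v)"
      "\<Phi> (\<tau> + v) = \<Phi> \<tau> + deriv \<Phi> \<tau> * (\<tau> + v - \<tau>) + deriv (deriv \<Phi>) z / 2 * (\<tau> + v - \<tau>)\<^sup>2"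
      using Taylor_second_order[OF smooth] by blast
    then have "deriv (deriv \<Phi>) z / 2 * v\<^sup>2 \<le> M / 2 * v\<^sup>2"
      using curv[of z] that
      by (intro mult_right_mono) (auto simp: closed_segment_eq_real_ivl split: if_splits)
    then show ?thesis
      using z by simp
  qed
  have "(1 - t) / 2 * \<Phi> (\<tau> + u) \<le> (1 - t) / 2 * (\<Phi> \<tau> + deriv \<Phi> \<tau> * u + M / 2 * u\<^sup>2)"
       "(1 + t) / 2 * \<Phi> (\<tau> - u) \<le> (1 + t) / 2 * (\<Phi> \<tau> - deriv \<Phi> \<tau> * u + M / 2 * u\<^sup>2)"
    using upper[of u] upper[of "- u"] u t by (intro mult_left_mono; simp)+
  then have "t * deriv \<Phi> \<tau> * u - M / 2 * u\<^sup>2 \<le> gap \<Phi> t \<tau> u"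
    by (simp add: gap_def field_simps)
  moreover have "t * p * u \<le> t * deriv \<Phi> \<tau> * u"
    using p t u by (intro mult_right_mono mult_left_mono) auto
  moreover have "t * p * u - M / 2 * u\<^sup>2 = p\<^sup>2 / (2 * M) * t\<^sup>2"
    using M by (simp add: u_def field_simps power2_eq_square)
  ultimately show ?thesis
    unfolding u_def by linarith
qed

theorem theorem10:
  fixes \<Phi> :: "real \<Rightarrow> real" and A :: real
  assumes "\<And>x. 0 \<le> \<Phi> x"
    and "mono \<Phi>"
    and "convex_on UNIV \<Phi>"
    and "twice_continuously_differentiable \<Phi>"
    and "\<And>u. 0 \<le> u \<Longrightarrow> 0 < deriv \<Phi> u"
    and "\<And>u. 0 \<le> u \<Longrightarrow> 0 < deriv (deriv \<Phi>) u"
    and "0 < A"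
  shows "\<exists>C>0. \<exists>c>0. \<exists>T>0. T \<le> 1 \<and>
           (\<forall>t. 0 < t \<and> t \<le> T \<longrightarrow> G \<Phi> A t \<le> C * t\<^sup>2 \<and> c * t\<^sup>2 \<le> G \<Phi> A t)"
proof -
  note smooth = assms(4)
  define p where "p = deriv \<Phi> 0"
  have p: "0 < p"
    using assms(5)[of 0] by (simp add: p_def)
  have cont: "continuous_on S (deriv (deriv \<Phi>))" for S
    using smooth continuous_on_subset unfolding twice_continuously_differentiable_def by blast
  \<comment> \<open>The minimum of the second derivative on the compact interval is attained, hence
    positive.\<close>
  obtain z where z: "z \<in> {0..A}" "\<And>x. x \<in> {0..A} \<Longrightarrow> deriv (deriv \<Phi>) z \<le> deriv (deriv \<Phi>) x"
    using continuous_attains_inf[of "{0..A}" "deriv (deriv \<Phi>)"] cont assms(7) by auto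
  define m where "m = deriv (deriv \<Phi>) z"
  have m: "0 < m"
    using z(1) assms(6) by (simp add: m_def)
  \<comment> \<open>This interval contains \<open>{\<tau> - 1..\<tau> + 1}\<close> for every
    \<open>\<tau>\<close> in \<open>{0..A}\<close>.\<close>
  obtain y where y: "\<And>x. x \<in> {-1..A + 1} \<Longrightarrow> deriv (deriv \<Phi>) x \<le> deriv (deriv \<Phi>) y"
    using continuous_attains_sup[OF _ _ cont, of "{-1..A + 1}"] assms(7) by fastforce
  define M where "M = max p (deriv (deriv \<Phi>) y)"
  have M: "0 < M" "p \<le> M"
    using p by (auto simp: M_def)
  \<comment> \<open>The derivative is nondecreasing on the nonnegative axis, so its value at 0 is a
    slope bound uniform in \<open>\<tau>\<close>.\<close>
  have deriv_ge: "p \<le> deriv \<Phi> \<tau>" if "0 \<le> \<tau>" for \<tau>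
    unfolding p_def
    by (rule DERIV_nonneg_imp_nondecreasing[OF that])
      (use twice_continuously_differentiable_derivs(2)[OF smooth] assms(6) less_imp_le in blast)
  \<comment> \<open>The two bounds are the smallness conditions on \<open>t\<close> in
    \<open>gap_upper_bound\<close>.\<close>
  define T where "T = min (1 / 2) (m * A / (8 * p))"
  have "G \<Phi> A t \<le> 2 * p\<^sup>2 / m * t\<^sup>2 \<and> p\<^sup>2 / (2 * M) * t\<^sup>2 \<le> G \<Phi> A t"
    if t: "0 < t" "t \<le> T" for t
  proof
    have t': "0 \<le> t" "t \<le> 1" "t \<le> 1 / 2" "8 * p * t \<le> m * A"
      using t p by (auto simp: T_def field_simps)
    have "G \<Phi> A t \<le> (SUP u. gap \<Phi> t 0 u)"
      unfolding G_def
      by (rule cINF_lower[OF bdd_below_SUP_gap]) (use assms(1,7) t' in auto)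
    also have "\<dots> \<le> 2 * p\<^sup>2 / m * t\<^sup>2"
      unfolding p_def
      by (intro cSUP_least gap_upper_bound[OF assms(3) smooth _ m assms(7)])
        (use z(2) p t' in \<open>auto simp: m_def p_def\<close>)
    finally show "G \<Phi> A t \<le> 2 * p\<^sup>2 / m * t\<^sup>2" .
    \<comment> \<open>Neither \<open>p\<close> nor \<open>M\<close> depends on
      \<open>\<tau>\<close>, so the bound passes to the infimum.\<close>
    have "p\<^sup>2 / (2 * M) * t\<^sup>2 \<le> (SUP u. gap \<Phi> t \<tau> u)" if \<tau>: "\<tau> \<in> {0..A}" for \<tau>
    proof (rule order_trans)
      show "p\<^sup>2 / (2 * M) * t\<^sup>2 \<le> gap \<Phi> t \<tau> (p / M * t)"
      proof (rule gap_lower_bound[OF smooth])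
        show "deriv (deriv \<Phi>) x \<le> M" if "x \<in> {\<tau> - 1..\<tau> + 1}" for x
          using y[of x] that \<tau> by (auto simp: M_def)
      qed (use p M \<tau> t' deriv_ge in auto)
      show "gap \<Phi> t \<tau> (p / M * t) \<le> (SUP u. gap \<Phi> t \<tau> u)"
        by (rule cSUP_upper[OF UNIV_I bdd_above_gap]) (use assms(1) t' in auto)
    qed
    then show "p\<^sup>2 / (2 * M) * t\<^sup>2 \<le> G \<Phi> A t"
      unfolding G_def using assms(7) by (intro cINF_greatest) auto
  qed
  moreover have "0 < 2 * p\<^sup>2 / m" "0 < p\<^sup>2 / (2 * M)" "0 < T" "T \<le> 1"
    using p m M assms(7) by (auto simp: T_def)
  ultimately show ?thesis
    by blast
qed

end
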